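(* Let $0<\alpha<1$, let $\Omega=(a,b)$, and let $\kappa$ satisfy $c_0\le\kappa(x)\le c_1$ on $\Omega$ for some positive constants $c_0,c_1$. Then the finite difference solution $U^n$ of the right-sided scheme $$\kappa^{n-1/2}\,\big({}_xI_b^{1-\alpha}\,\delta U\big)(x_{n-1})-\kappa^{n+1/2}\,\big({}_xI_b^{1-\alpha}\,\delta U\big)(x_{n})=h^2 f^n,\qquad n=1,\dots,P-1,$$ with $U^0=U^P=0$, exists and is unique.
   Context: Uniform mesh: $P\ge 2$ is an integer, $h=(b-a)/P$, $x_n=a+nh$ for $0\le n\le P$, $I_n=(x_{n-1},x_n)$, $x_{n+1/2}=(x_n+x_{n+1})/2$, $\kappa^{n+1/2}=\kappa(x_{n+1/2})$, $f^n=f(x_n)$ where $f$ is a given source function on $\Omega$. For nodal values $U^0,\dots,U^P$, the backward difference $\delta U$ is the piecewise constant function $\delta U(x)=\delta U^n:=U^n-U^{n-1}$ for $x\in I_n$. The right-sided Riemann–Liouville fractional integral is ${}_xI_b^{1-\alpha}v(x)=\int_x^b\omega_{1-\alpha}(z-x)v(z)\,dz$ with $\omega_{1-\alpha}(x)=x^{-\alpha}/\Gamma(1-\alpha)$. Hence $$\big({}_xI_b^{1-\alpha}\delta U\big)(x_{n-1})=\sum_{j=n}^P \delta U^j\int_{I_j}\omega_{1-\alpha}(s-x_{n-1})\,ds=\omega_{2-\alpha}(h)\sum_{j=n}^P w_{j,n}\,\delta U^j,$$ where $\omega_{2-\alpha}(h)=h^{1-\alpha}/\Gamma(2-\alpha)$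 and $w_{n,j}=(n+1-j)^{1-\alpha}-(n-j)^{1-\alpha}$ for $n\ge j\ge1$. The scheme approximates the problem $-\partial_x(\kappa\,{}_xD_b^{\alpha}u)=f$ on $\Omega$ with $u(a)=u(b)=0$, where ${}_xD_b^{\alpha}v=\partial_x\,{}_xI_b^{1-\alpha}v$ (no minus sign). *)

theory Defs
  imports "HOL-Analysis.Analysis" "HOL-Library.FuncSet"
begin

definition frac_kernel :: "real \<Rightarrow> real \<Rightarrow> real" where
  "frac_kernel \<beta> x = x powr (\<beta> - 1) / Gamma \<beta>"

text \<open>Right-sided Riemann--Liouville fractional integral of order \<open>\<beta>\<close>. At \<open>z = x\<close> the kernel
  takes the value \<open>0 powr (\<beta> - 1) = 0\<close> instead of being singular; this is a null set.\<close>

definition right_RL_integral :: "real \<Rightarrow> real \<Rightarrow> (real \<Rightarrow> real) \<Rightarrow> real \<Rightarrow> real" where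
  "right_RL_integral b \<beta> v x = (LBINT z:{x..b}. frac_kernel \<beta> (z - x) * v z)"

definition mesh_width :: "real \<Rightarrow> real \<Rightarrow> nat \<Rightarrow> real" where
  "mesh_width a b P = (b - a) / real P"

definition mesh_node :: "real \<Rightarrow> real \<Rightarrow> nat \<Rightarrow> nat \<Rightarrow> real" where
  "mesh_node a b P n = a + real n * mesh_width a b P"

text \<open>Midpoint of the cell between nodes \<open>n\<close> and \<open>n + 1\<close>, i.e. $x_{n+1/2}$.\<close>

definition mesh_mid :: "real \<Rightarrow> real \<Rightarrow> nat \<Rightarrow> nat \<Rightarrow> real" where
  "mesh_mid a b P n = (mesh_node a b P n + mesh_node a b P (n + 1)) / 2"

text \<open>The piecewise constant function equal to \<open>U n - U (n - 1)\<close> on the open cell between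
  nodes \<open>n - 1\<close> and \<open>n\<close>. Its values at the nodes and outside the mesh are set to 0; they do not
  influence the integrals below.\<close>

definition backward_diff :: "real \<Rightarrow> real \<Rightarrow> nat \<Rightarrow> (nat \<Rightarrow> real) \<Rightarrow> real \<Rightarrow> real" where
  "backward_diff a b P U x =
     (\<Sum>n = 1..P. (U n - U (n - 1)) *
        indicator {mesh_node a b P (n - 1)<..<mesh_node a b P n} x)"

definition right_fd_solution ::
    "real \<Rightarrow> real \<Rightarrow> real \<Rightarrow> (real \<Rightarrow> real) \<Rightarrow> (real \<Rightarrow> real) \<Rightarrow> nat \<Rightarrow> (nat \<Rightarrow> real) \<Rightarrow> bool" where
  "right_fd_solution \<alpha> a b \<kappa> f P U \<longleftrightarrow>
     U 0 = 0 \<and> U P = 0 \<and>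
     (\<forall>n \<in> {1..P - 1}.
        \<kappa> (mesh_mid a b P (n - 1)) *
          right_RL_integral b (1 - \<alpha>) (backward_diff a b P U) (mesh_node a b P (n - 1))
        - \<kappa> (mesh_mid a b P n) *
          right_RL_integral b (1 - \<alpha>) (backward_diff a b P U) (mesh_node a b P n)
        = (mesh_width a b P)\<^sup>2 * f (mesh_node a b P n))"

end

theory Submission
  imports Defs
begin

text \<open>
  Let \<open>F n\<close> be the fractional integral of the backward difference at node \<open>n\<close>. Exact integration of
  the kernel over the cells gives, up to a positive factor, \<open>F n = (\<Sum>j>n. w (j - n - 1) * (U j - U (j - 1)))\<close>,
  where the weights \<open>w i\<close> are the increments of \<open>t powr (1 - \<alpha>)\<close> over \<open>[i, i + 1]\<close>. They start at
  \<open>w 0 = 1\<close> and decrease, since \<open>t powr (1 - \<alpha>)\<close> is concave. Count nodes from the right end, where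
  \<open>U\<close> vanishes, and put \<open>r k = - U (P - k)\<close>. Summation by parts then turns \<open>F (P - k)\<close> into the
  residual \<open>r k - (\<Sum>j<k. \<mu> (k - j) * r j)\<close> of a Volterra equation whose memory weights
  \<open>\<mu> m = w (m - 1) - w m\<close> are nonnegative (\<open>memory_weight_nonneg\<close>, \<open>right_RL_integral_eq_residual\<close>).

  Nonnegative memory makes the equation positivity preserving: if \<open>r 0 = 0\<close> and all later residuals
  are positive, then so are all later values of \<open>r\<close> (\<open>volterra_positive\<close>). The scheme prescribes
  the increments of \<open>\<rho> k\<close> times the residual, where \<open>\<rho>\<close> is \<open>\<kappa>\<close> at the midpoints up to the positive
  factor. Hence this flux is known up to its first value \<open>C\<close>, and each \<open>C\<close> determines \<open>r\<close> by forward
  recursion. The value of \<open>r\<close> at the far end is an affine function of \<open>C\<close>. Its slope is the end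
  value of the \<open>r\<close> with constant flux 1, whose residuals \<open>1 / \<rho> k\<close> are positive; so the slope is
  positive, and exactly one \<open>C\<close> meets the condition \<open>r P = 0\<close>.
\<close>

section \<open>Discrete Volterra equations with nonnegative memory\<close>

definition volterra_residual :: "(nat \<Rightarrow> real) \<Rightarrow> (nat \<Rightarrow> real) \<Rightarrow> nat \<Rightarrow> real" where
  "volterra_residual \<mu> r k = r k - (\<Sum>j<k. \<mu> (k - j) * r j)"

lemma volterra_residual_linear:
  "volterra_residual \<mu> (\<lambda>k. x * r k + y * s k) k =
     x * volterra_residual \<mu> r k + y * volterra_residual \<mu> s k"
  by (simp add: volterra_residual_def algebra_simps sum.distrib sum_distrib_left)

function volterra_solution :: "(nat \<Rightarrow> real) \<Rightarrow> (nat \<Rightarrow> real) \<Rightarrow> nat \<Rightarrow> real" where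
  "volterra_solution \<mu> g k = g k + (\<Sum>j<k. \<mu> (k - j) * volterra_solution \<mu> g j)"
  by auto
termination by (relation "Wellfounded.measure (\<lambda>(\<mu>, g, k). k)") auto

declare volterra_solution.simps [simp del]

lemma volterra_residual_solution:
  "volterra_residual \<mu> (volterra_solution \<mu> g) k = g k"
  by (simp add: volterra_residual_def volterra_solution.simps[of \<mu> g k])

text \<open>A discrete maximum principle: each value is its residual plus a nonnegative combination of
  earlier values.\<close>

lemma volterra_positive:
  assumes mu: "\<And>i. 0 \<le> \<mu> i"
    and "r 0 = 0"
    and res: "\<And>k. k \<in> {1..P} \<Longrightarrow> 0 < volterra_residual \<mu> r k"
    and "k \<in> {1..P}"
  shows "0 < r k"
  using \<open>k \<in> {1..P}\<close>
proof (induction k rule: less_induct)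
  case (less k)
  have "0 \<le> r j" if "j < k" for j
    using less.IH[of j] less.prems \<open>r 0 = 0\<close> that by (cases "j = 0") auto
  then have "0 \<le> (\<Sum>j<k. \<mu> (k - j) * r j)"
    by (intro sum_nonneg mult_nonneg_nonneg mu) auto
  then show ?case
    using res[OF less.prems] by (simp add: volterra_residual_def)
qed

lemma volterra_trivial:
  assumes "r 0 = 0"
    and res: "\<And>k. k \<in> {1..P} \<Longrightarrow> volterra_residual \<mu> r k = 0"
    and "k \<le> P"
  shows "r k = 0"
  using \<open>k \<le> P\<close>
proof (induction k rule: less_induct)
  case (less k)
  have "(\<Sum>j<k. \<mu> (k - j) * r j) = 0"
    using less by (intro sum.neutral) auto
  then show ?case
    using res[of k] less.prems \<open>r 0 = 0\<close> by (cases "k = 0") (auto simp: volterra_residual_def)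
qed

section \<open>The two-point problem for a discrete flux\<close>

text \<open>The scheme with the nodes counted from the right end: \<open>\<rho>\<close> carries the coefficient \<open>\<kappa>\<close> and \<open>q\<close> the
  source. There are \<open>P\<close> fluxes and \<open>P - 1\<close> equations between them, which leaves one flux constant to be
  fixed by \<open>r P = 0\<close>.\<close>

definition flux_problem ::
    "(nat \<Rightarrow> real) \<Rightarrow> (nat \<Rightarrow> real) \<Rightarrow> (nat \<Rightarrow> real) \<Rightarrow> nat \<Rightarrow> (nat \<Rightarrow> real) \<Rightarrow> bool" where
  "flux_problem \<mu> \<rho> q P r \<longleftrightarrow>
     r 0 = 0 \<and> r P = 0 \<and>
     (\<forall>k\<in>{1..<P}. \<rho> (Suc k) * volterra_residual \<mu> r (Suc k) - \<rho> k * volterra_residual \<mu> r k = q k)"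

text \<open>Without a source the flux is a constant \<open>C\<close>. If \<open>C\<close> were nonzero, all residuals of \<open>r / C\<close> would
  be positive, and positivity at \<open>P\<close> would contradict the end condition.\<close>

lemma flux_problem_homogeneous:
  assumes mu: "\<And>i. 0 \<le> \<mu> i"
    and rho: "\<And>k. k \<in> {1..P} \<Longrightarrow> 0 < \<rho> k"
    and sol: "flux_problem \<mu> \<rho> (\<lambda>_. 0) P r"
    and "k \<le> P"
  shows "r k = 0"
proof (cases "P = 0")
  case True
  then show ?thesis using sol \<open>k \<le> P\<close> by (simp add: flux_problem_def)
next
  case False
  define C where "C = \<rho> 1 * volterra_residual \<mu> r 1"
  have const: "\<rho> k * volterra_residual \<mu> r k = C" if "k \<in> {1..P}" for k
    using that
  proof (induction k)
    case (Suc k)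
    then show ?case
      using sol by (cases "k = 0") (auto simp: C_def flux_problem_def)
  qed simp
  have "C = 0"
  proof (rule ccontr)
    assume "C \<noteq> 0"
    \<comment> \<open>The term with factor 0 puts \<open>r / C\<close> into the shape of \<open>volterra_residual_linear\<close>.\<close>
    have "0 < volterra_residual \<mu> (\<lambda>k. (1 / C) * r k + 0 * r k) k" if "k \<in> {1..P}" for k
    proof -
      have "volterra_residual \<mu> r k = C / \<rho> k"
        using const[OF that] rho[OF that] by (simp add: field_simps)
      then show ?thesis
        using rho[OF that] \<open>C \<noteq> 0\<close> by (simp only: volterra_residual_linear) simp
    qed
    then have "0 < (1 / C) * r P + 0 * r P"
      by (rule volterra_positive[where P = P and \<mu> = \<mu> and r = "\<lambda>k. (1 / C) * r k + 0 * r k", rotated 2])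
        (use mu sol False in \<open>auto simp: flux_problem_def\<close>)
    then show False
      using sol by (simp add: flux_problem_def)
  qed
  then have "volterra_residual \<mu> r k = 0" if "k \<in> {1..P}" for k
    using const[OF that] rho[OF that] by simp
  then show ?thesis
    using volterra_trivial[of r P \<mu> k] sol \<open>k \<le> P\<close> by (auto simp: flux_problem_def)
qed

lemma flux_problem_unique:
  assumes mu: "\<And>i. 0 \<le> \<mu> i"
    and rho: "\<And>k. k \<in> {1..P} \<Longrightarrow> 0 < \<rho> k"
    and r: "flux_problem \<mu> \<rho> q P r" and s: "flux_problem \<mu> \<rho> q P s"
    and "k \<le> P"
  shows "r k = s k"
proof -
  have "flux_problem \<mu> \<rho> (\<lambda>_. 0) P (\<lambda>k. 1 * r k + (- 1) * s k)"
    unfolding flux_problem_def volterra_residual_linear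
  proof (intro conjI ballI)
    fix k assume k: "k \<in> {1..<P}"
    have "\<rho> (Suc k) * volterra_residual \<mu> r (Suc k) - \<rho> k * volterra_residual \<mu> r k = q k"
      "\<rho> (Suc k) * volterra_residual \<mu> s (Suc k) - \<rho> k * volterra_residual \<mu> s k = q k"
      using r s k by (auto simp: flux_problem_def)
    then show "\<rho> (Suc k) * (1 * volterra_residual \<mu> r (Suc k) + - 1 * volterra_residual \<mu> s (Suc k)) -
        \<rho> k * (1 * volterra_residual \<mu> r k + - 1 * volterra_residual \<mu> s k) = 0"
      by (simp add: algebra_simps)
  qed (use r s in \<open>auto simp: flux_problem_def\<close>)
  from flux_problem_homogeneous[OF mu rho this \<open>k \<le> P\<close>] show ?thesis
    by simp
qed

text \<open>Shooting: a particular solution with the right flux increments and \<open>r 0 = 0\<close> is corrected by a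
  multiple of the solution with constant flux 1, whose value at \<open>P\<close> is nonzero by positivity.\<close>

lemma flux_problem_exists:
  assumes mu: "\<And>i. 0 \<le> \<mu> i"
    and rho: "\<And>k. k \<in> {1..P} \<Longrightarrow> 0 < \<rho> k"
    and "1 \<le> P"
  shows "\<exists>r. flux_problem \<mu> \<rho> q P r"
proof -
  define r where "r = volterra_solution \<mu> (\<lambda>k. (\<Sum>i = 1..<k. q i) / \<rho> k)"
  define s where "s = volterra_solution \<mu> (\<lambda>k. if k = 0 then 0 else 1 / \<rho> k)"
  have s0: "s 0 = 0" and r0: "r 0 = 0"
    by (simp_all add: r_def s_def volterra_solution.simps[of _ _ 0])
  have "0 < s P"
    by (rule volterra_positive[where P = P and \<mu> = \<mu> and r = s])
      (use mu s0 rho \<open>1 \<le> P\<close> in \<open>auto simp: s_def volterra_residual_solution\<close>)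
  have res_r: "\<rho> k * volterra_residual \<mu> r k = (\<Sum>i = 1..<k. q i)" if "k \<in> {1..P}" for k
    using rho[OF that] by (simp add: r_def volterra_residual_solution)
  have res_s: "\<rho> k * volterra_residual \<mu> s k = 1" if "k \<in> {1..P}" for k
    using rho[OF that] that by (simp add: s_def volterra_residual_solution)
  have "flux_problem \<mu> \<rho> q P (\<lambda>k. 1 * r k + (- r P / s P) * s k)"
    unfolding flux_problem_def volterra_residual_linear
  proof (intro conjI ballI)
    fix k assume "k \<in> {1..<P}"
    then have k: "k \<in> {1..P}" "Suc k \<in> {1..P}" by auto
    define c where "c = - r P / s P"
    have "\<rho> (Suc k) * (1 * volterra_residual \<mu> r (Suc k) + c * volterra_residual \<mu> s (Suc k)) -
        \<rho> k * (1 * volterra_residual \<mu> r k + c * volterra_residual \<mu> s k) =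
        (\<rho> (Suc k) * volterra_residual \<mu> r (Suc k) - \<rho> k * volterra_residual \<mu> r k) +
        c * (\<rho> (Suc k) * volterra_residual \<mu> s (Suc k) - \<rho> k * volterra_residual \<mu> s k)"
      by (simp add: algebra_simps)
    also have "\<dots> = q k"
      unfolding res_r[OF k(1)] res_r[OF k(2)] res_s[OF k(1)] res_s[OF k(2)]
      using k by simp
    finally show "\<rho> (Suc k) * (1 * volterra_residual \<mu> r (Suc k) + - r P / s P * volterra_residual \<mu> s (Suc k)) -
        \<rho> k * (1 * volterra_residual \<mu> r k + - r P / s P * volterra_residual \<mu> s k) = q k"
      by (simp only: c_def)
  qed (use s0 r0 \<open>0 < s P\<close> in auto)
  then show ?thesis by (rule exI[where P = "flux_problem \<mu> \<rho> q P"])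
qed

section \<open>The fractional integral of a backward difference\<close>

text \<open>Named after the L1 discretisation of fractional derivatives, whose weights these are.\<close>

definition L1_weight :: "real \<Rightarrow> nat \<Rightarrow> real" where
  "L1_weight \<alpha> i = (real i + 1) powr (1 - \<alpha>) - real i powr (1 - \<alpha>)"

text \<open>Concavity of the power function. Only continuity is available at 0, where the derivative may blow up,
  so the sign of the derivative is used in the interior alone.\<close>

lemma powr_increment_antimono:
  fixes \<beta> x y :: real
  assumes "0 < \<beta>" "\<beta> \<le> 1" "0 \<le> x" "x \<le> y"
  shows "(y + 1) powr \<beta> - y powr \<beta> \<le> (x + 1) powr \<beta> - x powr \<beta>"
proof (cases "x = y")
  case False
  then have "x < y" using assms by simp
  show ?thesis
  proof (rule DERIV_nonpos_imp_decreasing_open[of x y "\<lambda>t. (t + 1) powr \<beta> - t powr \<beta>"])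
    show "x \<le> y" by fact
    show "\<exists>D. ((\<lambda>t. (t + 1) powr \<beta> - t powr \<beta>) has_real_derivative D) (at t) \<and> D \<le> 0"
      if "x < t" "t < y" for t
    proof (intro exI conjI)
      show "((\<lambda>t. (t + 1) powr \<beta> - t powr \<beta>) has_real_derivative
          \<beta> * (t + 1) powr (\<beta> - 1) - \<beta> * t powr (\<beta> - 1)) (at t)"
        using assms that by (auto intro!: derivative_eq_intros)
      show "\<beta> * (t + 1) powr (\<beta> - 1) - \<beta> * t powr (\<beta> - 1) \<le> 0"
        using assms that by (auto intro!: mult_left_mono powr_mono2')
    qed
    show "continuous_on {x..y} (\<lambda>t. (t + 1) powr \<beta> - t powr \<beta>)"
      using assms by (intro continuous_intros continuous_on_powr') auto
  qed
qed simp

text \<open>The kernel that summation by parts produces. At \<open>m = 0\<close> truncated subtraction gives the value 0,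
  so nonnegativity holds for every index.\<close>

definition memory_weight :: "real \<Rightarrow> nat \<Rightarrow> real" where
  "memory_weight \<alpha> m = L1_weight \<alpha> (m - 1) - L1_weight \<alpha> m"

lemma memory_weight_nonneg:
  assumes "0 < \<alpha>" "\<alpha> < 1"
  shows "0 \<le> memory_weight \<alpha> m"
  using powr_increment_antimono[of "1 - \<alpha>" "real (m - 1)" "real m"] assms
  by (simp add: memory_weight_def L1_weight_def)

text \<open>For \<open>p = x\<close> the integrand may blow up at the left end; the primitive is still continuous there,
  which is all that the fundamental theorem in its gauge integral form asks for. Nonnegativity of the
  integrand then makes the integral absolutely convergent.\<close>

lemma has_bochner_integral_powr_cell:
  fixes \<alpha> x p q :: real
  assumes "\<alpha> < 1" "x \<le> p" "p \<le> q"
  shows "has_bochner_integral lborel (\<lambda>z. indicator {p<..<q} z * (z - x) powr - \<alpha>)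
           (((q - x) powr (1 - \<alpha>) - (p - x) powr (1 - \<alpha>)) / (1 - \<alpha>))"
proof -
  have "((\<lambda>z. (z - x) powr - \<alpha>) has_integral
      (q - x) powr (1 - \<alpha>) / (1 - \<alpha>) - (p - x) powr (1 - \<alpha>) / (1 - \<alpha>)) {p..q}"
  proof (rule fundamental_theorem_of_calculus_interior[OF \<open>p \<le> q\<close>])
    show "continuous_on {p..q} (\<lambda>z. (z - x) powr (1 - \<alpha>) / (1 - \<alpha>))"
      using assms by (intro continuous_intros continuous_on_powr') auto
    show "((\<lambda>z. (z - x) powr (1 - \<alpha>) / (1 - \<alpha>)) has_vector_derivative (z - x) powr - \<alpha>) (at z)"
      if "z \<in> {p<..<q}" for z
      unfolding has_real_derivative_iff_has_vector_derivative[symmetric]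
      using that assms by (auto intro!: derivative_eq_intros)
  qed
  then have I: "((\<lambda>z. (z - x) powr - \<alpha>) has_integral
      ((q - x) powr (1 - \<alpha>) - (p - x) powr (1 - \<alpha>)) / (1 - \<alpha>)) {p<..<q}"
    by (simp add: has_integral_Icc_iff_Ioo diff_divide_distrib)
  have "set_integrable lebesgue {p<..<q} (\<lambda>z. (z - x) powr - \<alpha>)"
    using I by (intro nonnegative_absolutely_integrable_1) auto
  then have int: "set_integrable lborel {p<..<q} (\<lambda>z. (z - x) powr - \<alpha>)"
    unfolding set_integrable_def by (subst (asm) integrable_completion) auto
  with I show ?thesis
    using set_borel_integral_eq_integral(2)[OF int]
    by (simp add: has_bochner_integral_iff set_integrable_def set_lebesgue_integral_def
        integral_unique)
qed

lemma mesh_node_le_iff: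
  assumes "a < b" "1 \<le> P"
  shows "mesh_node a b P m \<le> mesh_node a b P n \<longleftrightarrow> m \<le> n"
proof -
  have "0 < mesh_width a b P"
    using assms by (simp add: mesh_width_def)
  then show ?thesis
    by (simp add: mesh_node_def)
qed

lemma mesh_node_last: "1 \<le> P \<Longrightarrow> mesh_node a b P P = b"
  by (simp add: mesh_node_def mesh_width_def)

lemma mesh_mid_interior:
  assumes "a < b" "n < P"
  shows "mesh_mid a b P n \<in> {a<..<b}"
proof -
  have "0 < mesh_width a b P"
    using assms by (simp add: mesh_width_def)
  moreover have "mesh_node a b P (n + 1) \<le> mesh_node a b P P"
    using assms by (subst mesh_node_le_iff) auto
  ultimately show ?thesis
    using mesh_node_last[of P a b] assms
    by (auto simp: mesh_mid_def mesh_node_def algebra_simps add_pos_nonneg)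
qed

text \<open>Only the cells to the right of the node contribute, and on each of them the difference is a
  constant multiplying an exactly computable integral of the kernel. By uniformity of the mesh the
  weight depends only on the distance between cell and node.\<close>

lemma right_RL_integral_backward_diff:
  assumes "0 < \<alpha>" "\<alpha> < 1" "a < b" "n \<le> P" "1 \<le> P"
  shows "right_RL_integral b (1 - \<alpha>) (backward_diff a b P U) (mesh_node a b P n) =
    mesh_width a b P powr (1 - \<alpha>) / Gamma (2 - \<alpha>) *
      (\<Sum>j = Suc n..P. L1_weight \<alpha> (j - Suc n) * (U j - U (j - 1)))"
proof -
  define x where "x = mesh_node a b P"
  define h where "h = mesh_width a b P"
  define J where "J j = {x (j - 1)<..<x j}" for j
  have h: "0 < h"
    using assms by (simp add: h_def mesh_width_def)
  have le: "x i \<le> x j \<longleftrightarrow> i \<le> j" for i j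
    unfolding x_def using assms by (intro mesh_node_le_iff)
  have xP: "x P = b"
    unfolding x_def using assms by (intro mesh_node_last)
  have integrand: "indicator {x n..b} z * (frac_kernel (1 - \<alpha>) (z - x n) * backward_diff a b P U z) =
      (\<Sum>j = Suc n..P. (U j - U (j - 1)) / Gamma (1 - \<alpha>) *
         (indicator (J j) z * (z - x n) powr - \<alpha>))" (is "?lhs = ?rhs") for z
  proof -
    have "?lhs = (\<Sum>j = 1..P. (U j - U (j - 1)) / Gamma (1 - \<alpha>) *
        (indicator ({x n..b} \<inter> J j) z * (z - x n) powr - \<alpha>))"
      unfolding backward_diff_def J_def x_def sum_distrib_left
      by (intro sum.cong refl) (simp add: frac_kernel_def indicator_inter_arith mult_ac)
    also have "\<dots> = (\<Sum>j = Suc n..P. (U j - U (j - 1)) / Gamma (1 - \<alpha>) *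
        (indicator ({x n..b} \<inter> J j) z * (z - x n) powr - \<alpha>))"
    proof (rule sum.mono_neutral_right)
      show "\<forall>j\<in>{1..P} - {Suc n..P}. (U j - U (j - 1)) / Gamma (1 - \<alpha>) *
        (indicator ({x n..b} \<inter> J j) z * (z - x n) powr - \<alpha>) = 0"
      proof
        fix j assume "j \<in> {1..P} - {Suc n..P}"
        then have "j \<le> n" by (cases "j \<le> n") auto
        then have "x j \<le> x n" by (simp add: le)
        then have "z \<notin> {x n..b} \<inter> J j" by (auto simp: J_def)
        then show "(U j - U (j - 1)) / Gamma (1 - \<alpha>) *
          (indicator ({x n..b} \<inter> J j) z * (z - x n) powr - \<alpha>) = 0" by simp
      qed
    qed auto
    also have "\<dots> = ?rhs"
    proof (rule sum.cong[OF refl])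
      fix j assume j: "j \<in> {Suc n..P}"
      then have "x n \<le> x (j - 1)" "x j \<le> b"
        by (auto simp: le simp flip: xP)
      then have "{x n..b} \<inter> J j = J j" by (auto simp: J_def)
      then show "(U j - U (j - 1)) / Gamma (1 - \<alpha>) *
          (indicator ({x n..b} \<inter> J j) z * (z - x n) powr - \<alpha>) =
        (U j - U (j - 1)) / Gamma (1 - \<alpha>) * (indicator (J j) z * (z - x n) powr - \<alpha>)"
        by simp
    qed
    finally show ?thesis .
  qed
  have cell: "has_bochner_integral lborel (\<lambda>z. indicator (J j) z * (z - x n) powr - \<alpha>)
      (h powr (1 - \<alpha>) / (1 - \<alpha>) * L1_weight \<alpha> (j - Suc n))" if j: "j \<in> {Suc n..P}" for j
  proof -
    have 1: "x j - x n = h * (real (j - Suc n) + 1)" "x (j - 1) - x n = h * real (j - Suc n)"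
      using j by (auto simp: x_def mesh_node_def h_def of_nat_diff algebra_simps)
    have "x n \<le> x (j - 1)" "x (j - 1) \<le> x j"
      using j by (auto simp: le)
    note has_bochner_integral_powr_cell[OF \<open>\<alpha> < 1\<close> this]
    moreover have "((x j - x n) powr (1 - \<alpha>) - (x (j - 1) - x n) powr (1 - \<alpha>)) / (1 - \<alpha>) =
        h powr (1 - \<alpha>) / (1 - \<alpha>) * L1_weight \<alpha> (j - Suc n)"
      unfolding 1 using h by (simp add: powr_mult L1_weight_def right_diff_distrib diff_divide_distrib)
    ultimately show ?thesis
      by (simp only: J_def)
  qed
  have "has_bochner_integral lborel
      (\<lambda>z. \<Sum>j = Suc n..P. (U j - U (j - 1)) / Gamma (1 - \<alpha>) *
         (indicator (J j) z * (z - x n) powr - \<alpha>))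
      (\<Sum>j = Suc n..P. (U j - U (j - 1)) / Gamma (1 - \<alpha>) *
         (h powr (1 - \<alpha>) / (1 - \<alpha>) * L1_weight \<alpha> (j - Suc n)))"
    by (intro has_bochner_integral_sum has_bochner_integral_mult_right cell)
  then have "right_RL_integral b (1 - \<alpha>) (backward_diff a b P U) (x n) =
      (\<Sum>j = Suc n..P. (U j - U (j - 1)) / Gamma (1 - \<alpha>) *
         (h powr (1 - \<alpha>) / (1 - \<alpha>) * L1_weight \<alpha> (j - Suc n)))"
    by (simp add: right_RL_integral_def set_lebesgue_integral_def integrand
        has_bochner_integral_integral_eq)
  also have "\<dots> = h powr (1 - \<alpha>) / Gamma (2 - \<alpha>) *
      (\<Sum>j = Suc n..P. L1_weight \<alpha> (j - Suc n) * (U j - U (j - 1)))"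
  proof -
    have "Gamma (1 - \<alpha> + 1) = (1 - \<alpha>) * Gamma (1 - \<alpha>)"
      using assms by (intro Gamma_plus1) (auto elim!: nonpos_Ints_cases)
    then have "Gamma (2 - \<alpha>) = (1 - \<alpha>) * Gamma (1 - \<alpha>)"
      by (simp add: algebra_simps)
    then show ?thesis
      by (simp add: sum_distrib_left mult_ac)
  qed
  finally show ?thesis
    by (simp add: x_def h_def)
qed

section \<open>The scheme as a flux problem\<close>

text \<open>Summation by parts. The boundary term at index 0 vanishes with \<open>r 0\<close>, and the one at index \<open>k\<close> is
  \<open>r k\<close> itself because the first weight is 1.\<close>

lemma weighted_differences_eq_residual:
  assumes "r 0 = 0"
  shows "(\<Sum>i<k. L1_weight \<alpha> i * (r (k - i) - r (k - Suc i))) =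
    volterra_residual (memory_weight \<alpha>) r k"
proof (cases k)
  case 0
  then show ?thesis using assms by (simp add: volterra_residual_def)
next
  case (Suc m)
  define w where "w = L1_weight \<alpha>"
  have w0: "w 0 = 1" by (simp add: w_def L1_weight_def)
  have "(\<Sum>i<k. w i * (r (k - i) - r (k - Suc i))) =
      (\<Sum>i<k. w i * r (k - i)) - (\<Sum>i<k. w i * r (k - Suc i))"
    by (simp add: algebra_simps sum_subtractf)
  also have "(\<Sum>i<k. w i * r (k - i)) = r k + (\<Sum>i<m. w (Suc i) * r (k - Suc i))"
    unfolding Suc by (subst sum.lessThan_Suc_shift) (simp add: w0)
  also have "(\<Sum>i<m. w (Suc i) * r (k - Suc i)) = (\<Sum>i<k. w (Suc i) * r (k - Suc i))"
    using assms by (simp add: Suc)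
  also have "r k + (\<Sum>i<k. w (Suc i) * r (k - Suc i)) - (\<Sum>i<k. w i * r (k - Suc i)) =
      r k - (\<Sum>i<k. (w i - w (Suc i)) * r (k - Suc i))"
    by (simp add: algebra_simps sum_subtractf)
  also have "(\<Sum>i<k. (w i - w (Suc i)) * r (k - Suc i)) =
      (\<Sum>i<k. (w (k - Suc i) - w (Suc (k - Suc i))) * r i)"
    by (subst sum.nat_diff_reindex[symmetric]) (auto intro!: sum.cong)
  also have "\<dots> = (\<Sum>j<k. memory_weight \<alpha> (k - j) * r j)"
    by (intro sum.cong) (auto simp: memory_weight_def w_def Suc_diff_Suc)
  finally show ?thesis
    by (simp add: w_def volterra_residual_def)
qed

text \<open>The minus sign in \<open>- U (P - k)\<close> compensates the reversal of the differences caused by counting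
  from the right; the starting value 0 is the boundary condition at \<open>b\<close>.\<close>

lemma right_RL_integral_eq_residual:
  assumes "0 < \<alpha>" "\<alpha> < 1" "a < b" "k \<le> P" "1 \<le> P" "U P = 0"
  shows "right_RL_integral b (1 - \<alpha>) (backward_diff a b P U) (mesh_node a b P (P - k)) =
    mesh_width a b P powr (1 - \<alpha>) / Gamma (2 - \<alpha>) *
      volterra_residual (memory_weight \<alpha>) (\<lambda>k. - U (P - k)) k"
proof -
  have "(\<Sum>j = Suc (P - k)..P. L1_weight \<alpha> (j - Suc (P - k)) * (U j - U (j - 1))) =
      (\<Sum>i<k. L1_weight \<alpha> i * (- U (P - (k - i)) - (- U (P - (k - Suc i)))))"
    by (rule sum.reindex_bij_witness[of _ "\<lambda>i. Suc (P - k) + i" "\<lambda>j. j - Suc (P - k)"])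
      (use assms in \<open>auto simp: Suc_diff_le\<close>)
  also have "\<dots> = volterra_residual (memory_weight \<alpha>) (\<lambda>k. - U (P - k)) k"
    by (rule weighted_differences_eq_residual) (use assms in simp)
  finally show ?thesis
    using assms by (subst right_RL_integral_backward_diff) auto
qed

lemma right_fd_solution_iff_flux_problem:
  assumes "0 < \<alpha>" "\<alpha> < 1" "a < b" "1 \<le> P"
  shows "right_fd_solution \<alpha> a b \<kappa> f P U \<longleftrightarrow>
    flux_problem (memory_weight \<alpha>)
      (\<lambda>k. \<kappa> (mesh_mid a b P (P - k)) * (mesh_width a b P powr (1 - \<alpha>) / Gamma (2 - \<alpha>)))
      (\<lambda>k. (mesh_width a b P)\<^sup>2 * f (mesh_node a b P (P - k))) P (\<lambda>k. - U (P - k))"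
proof (cases "U P = 0")
  case False
  then show ?thesis by (simp add: right_fd_solution_def flux_problem_def)
next
  case True
  define c where "c = mesh_width a b P powr (1 - \<alpha>) / Gamma (2 - \<alpha>)"
  define L where "L = volterra_residual (memory_weight \<alpha>) (\<lambda>k. - U (P - k))"
  define E where "E n \<longleftrightarrow>
      \<kappa> (mesh_mid a b P (n - 1)) *
        right_RL_integral b (1 - \<alpha>) (backward_diff a b P U) (mesh_node a b P (n - 1))
      - \<kappa> (mesh_mid a b P n) *
        right_RL_integral b (1 - \<alpha>) (backward_diff a b P U) (mesh_node a b P n)
      = (mesh_width a b P)\<^sup>2 * f (mesh_node a b P n)" for n
  have E: "E (P - k) \<longleftrightarrow>
      \<kappa> (mesh_mid a b P (P - Suc k)) * c * L (Suc k) - \<kappa> (mesh_mid a b P (P - k)) * c * L k =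
      (mesh_width a b P)\<^sup>2 * f (mesh_node a b P (P - k))" if "k \<in> {1..<P}" for k
  proof -
    have "P - k - 1 = P - Suc k" by simp
    then show ?thesis
      using right_RL_integral_eq_residual[of \<alpha> a b k P U]
        right_RL_integral_eq_residual[of \<alpha> a b "Suc k" P U] assms True that
      by (simp add: E_def c_def L_def mult.assoc)
  qed
  have "(\<forall>n\<in>{1..P - 1}. E n) \<longleftrightarrow> (\<forall>k\<in>{1..<P}. E (P - k))"
  proof -
    have "{1..P - 1} = (\<lambda>k. P - k) ` {1..<P}"
    proof (intro set_eqI iffI)
      fix n assume "n \<in> {1..P - 1}"
      then have "n = P - (P - n)" "P - n \<in> {1..<P}" by auto
      then show "n \<in> (\<lambda>k. P - k) ` {1..<P}" by blast
    qed auto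
    then show ?thesis by simp
  qed
  then show ?thesis
    using E unfolding right_fd_solution_def flux_problem_def E_def[symmetric] c_def[symmetric]
      L_def[symmetric]
    by auto
qed

theorem lemma2:
  fixes \<alpha> a b c0 c1 :: real and \<kappa> f :: "real \<Rightarrow> real" and P :: nat
  assumes "0 < \<alpha>" and "\<alpha> < 1"
    and "a < b"
    and "0 < c0" and "0 < c1"
    and "\<And>x. x \<in> {a<..<b} \<Longrightarrow> c0 \<le> \<kappa> x \<and> \<kappa> x \<le> c1"
    and "2 \<le> P"
  shows "\<exists>!U. U \<in> extensional {0..P} \<and> right_fd_solution \<alpha> a b \<kappa> f P U"
proof -
  define \<rho> where "\<rho> k =
    \<kappa> (mesh_mid a b P (P - k)) * (mesh_width a b P powr (1 - \<alpha>) / Gamma (2 - \<alpha>))" for k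
  define q where "q k = (mesh_width a b P)\<^sup>2 * f (mesh_node a b P (P - k))" for k
  have iff: "right_fd_solution \<alpha> a b \<kappa> f P U \<longleftrightarrow>
      flux_problem (memory_weight \<alpha>) \<rho> q P (\<lambda>k. - U (P - k))" for U
    unfolding \<rho>_def[abs_def] q_def[abs_def]
    using assms by (intro right_fd_solution_iff_flux_problem) auto
  have mu: "0 \<le> memory_weight \<alpha> i" for i
    using assms by (intro memory_weight_nonneg)
  have rho: "0 < \<rho> k" if "k \<in> {1..P}" for k
  proof -
    have "mesh_mid a b P (P - k) \<in> {a<..<b}"
      using that assms by (intro mesh_mid_interior) auto
    then have "0 < \<kappa> (mesh_mid a b P (P - k))"
      using assms by force
    moreover have "0 < mesh_width a b P"
      using assms by (simp add: mesh_width_def)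
    moreover have "0 < Gamma (2 - \<alpha>)"
      using assms by (intro Gamma_real_pos) auto
    ultimately show ?thesis
      by (simp add: \<rho>_def)
  qed
  obtain r where r: "flux_problem (memory_weight \<alpha>) \<rho> q P r"
    using flux_problem_exists[OF mu rho] assms by fastforce
  define V where "V = restrict (\<lambda>n. - r (P - n)) {0..P}"
  have "flux_problem (memory_weight \<alpha>) \<rho> q P (\<lambda>k. - V (P - k))"
  proof -
    have V: "- V (P - k) = r k" if "k \<le> P" for k
      using that by (simp add: V_def)
    have "volterra_residual (memory_weight \<alpha>) (\<lambda>k. - V (P - k)) k =
        volterra_residual (memory_weight \<alpha>) r k" if "k \<le> P" for k
      unfolding volterra_residual_def using that V by auto
    then show ?thesis
      using r V[of 0] V[of P] by (simp add: flux_problem_def)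
  qed
  show ?thesis
  proof (rule ex1I[of _ V])
    show "V \<in> extensional {0..P} \<and> right_fd_solution \<alpha> a b \<kappa> f P V"
      unfolding iff by (intro conjI) (simp add: V_def, fact)
    fix W assume W: "W \<in> extensional {0..P} \<and> right_fd_solution \<alpha> a b \<kappa> f P W"
    show "W = V"
    proof (rule extensionalityI[of W "{0..P}"])
      fix n assume "n \<in> {0..P}"
      then have n: "n \<le> P" by simp
      from W have "flux_problem (memory_weight \<alpha>) \<rho> q P (\<lambda>k. - W (P - k))"
        by (simp add: iff)
      from flux_problem_unique[OF mu rho this \<open>flux_problem _ \<rho> q P (\<lambda>k. - V (P - k))\<close>, of "P - n"]
      show "W n = V n"
        using n by simp
    qed (use W in \<open>auto simp: V_def\<close>)
  qed
qed

end
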